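(* Let $p\ge 2$ and let $Y$ be a $p$-convex Banach space. Then there exists a constant $c>0$ (depending only on $p$ and $Y$) such that for every $m\ge 0$ the Laakso graph $G_m$, with $n=|G_m|$ vertices, satisfies $c_Y(G_m)\ge c(\log n)^{1/p}$; that is, the Laakso graph of cardinality $n$ incurs distortion $\Omega((\log n)^{1/p})$ in any embedding into a $p$-convex Banach space.
   Context: For $p\ge 2$, a Banach space $(Y,\|\cdot\|_Y)$ is $p$-convex if there exist a norm $|||\cdot|||$ on $Y$ equivalent to $\|\cdot\|_Y$ and a constant $K>0$ such that $|||x|||=|||y|||=1$ implies $\left|\left|\left|\frac{x+y}{2}\right|\right|\right|\le 1-K|||x-y|||^p$. For metric spaces $\mathscr{M},\mathscr{N}$, $c_{\mathscr{M}}(\mathscr{N})$ is the infimum of those $D>0$ for which there exist $r>0$ and $f:\mathscr{N}\to\mathscr{M}$ with $r\,d_{\mathscr{N}}(x,y)\le d_{\mathscr{M}}(f(x),f(y))\le Dr\,d_{\mathscr{N}}(x,y)$ for all $x,y\in\mathscr{N}$ (and $\infty$ if no such $D$ exists). Laakso graphs $\{G_i\}_{i=0}^\infty$: $G_0$ is a graph consisting of one edge of unit length (its endpoints are its two vertices). To construct $G_i$, take six copies of $G_{i-1}$ with metric scaled by $\frac14$; glue four of them cyclically by identifying pairs of endpoints (forming a cycle of four copies), and attach the remaining two copies, each by one of its endpoints, at two opposite gluing points; the two endpoints of $G_i$ are the free endpoints of these last two copies. (Equivalently, $G_i$ is obtained from $G_{i-1}$ by replacing each edge by a copy of $G_1$.)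 Each edge of $G_i$ has length $4^{-i}$, and the vertex set of $G_i$ is equipped with the resulting shortest-path metric $d_{G_i}$. *)

theory Defs
  imports "HOL-Analysis.Analysis"
begin

definition equivalent_norm :: "('a::real_normed_vector \<Rightarrow> real) \<Rightarrow> bool" where
  "equivalent_norm N \<longleftrightarrow>
     (\<forall>x. 0 \<le> N x) \<and> (\<forall>x. N x = 0 \<longleftrightarrow> x = 0) \<and>
     (\<forall>a x. N (a *\<^sub>R x) = \<bar>a\<bar> * N x) \<and>
     (\<forall>x y. N (x + y) \<le> N x + N y) \<and>
     (\<exists>A>0. \<exists>B>0. \<forall>x. A * norm x \<le> N x \<and> N x \<le> B * norm x)"

definition p_convex :: "real \<Rightarrow> 'a::real_normed_vector itself \<Rightarrow> bool" where
  "p_convex p (_ :: 'a itself) \<longleftrightarrow>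
     (\<exists>N :: 'a \<Rightarrow> real. equivalent_norm N \<and>
        (\<exists>K>0. \<forall>x y. N x = 1 \<longrightarrow> N y = 1 \<longrightarrow>
           N ((x + y) /\<^sub>R 2) \<le> 1 - K * N (x - y) powr p))"

text \<open>\<open>distortion M N\<close> is the distortion \<open>c\<^sub>M(N)\<close> of embedding \<open>N\<close> into \<open>M\<close>; the infimum of
  the empty set is \<open>\<infinity>\<close>.\<close>

definition distortion :: "'a metric \<Rightarrow> 'b metric \<Rightarrow> ereal" where
  "distortion M N = Inf {ereal D | D. D > 0 \<and>
     (\<exists>r>0. \<exists>f \<in> mspace N \<rightarrow> mspace M. \<forall>x \<in> mspace N. \<forall>y \<in> mspace N.
        r * mdist N x y \<le> mdist M (f x) (f y) \<and>
        mdist M (f x) (f y) \<le> D * r * mdist N x y)}"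

text \<open>\<open>End1\<close> and \<open>End2\<close> are the two endpoints of the graph, \<open>Glue 0, \<dots>, Glue 3\<close> the gluing
  points around the cycle in cyclic order, and \<open>Inner k v\<close> the vertex \<open>v\<close> of the \<open>k\<close>-th copy of
  the previous graph, where \<open>v\<close> is not an endpoint of that graph.\<close>

datatype laakso_vertex = End1 | End2 | Glue nat | Inner nat laakso_vertex

text \<open>The points at which the endpoints \<open>End1\<close> and \<open>End2\<close> of the six copies end up: copies 0 to 3
  form the cycle, copies 4 and 5 are attached at the opposite points \<open>Glue 0\<close> and \<open>Glue 2\<close>.\<close>

definition copy_ends :: "nat \<Rightarrow> laakso_vertex \<times> laakso_vertex" where
  "copy_ends k =
     [(Glue 0, Glue 1), (Glue 1, Glue 2), (Glue 3, Glue 2), (Glue 0, Glue 3),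
      (End1, Glue 0), (Glue 2, End2)] ! k"

fun place :: "nat \<Rightarrow> laakso_vertex \<Rightarrow> laakso_vertex" where
  "place k End1 = fst (copy_ends k)"
| "place k End2 = snd (copy_ends k)"
| "place k v = Inner k v"

fun laakso_verts :: "nat \<Rightarrow> laakso_vertex set" where
  "laakso_verts 0 = {End1, End2}"
| "laakso_verts (Suc i) = (\<Union>k<6. place k ` laakso_verts i)"

fun laakso_edges :: "nat \<Rightarrow> laakso_vertex set set" where
  "laakso_edges 0 = {{End1, End2}}"
| "laakso_edges (Suc i) = (\<Union>k<6. (\<lambda>e. place k ` e) ` laakso_edges i)"

definition laakso_adj :: "nat \<Rightarrow> (laakso_vertex \<times> laakso_vertex) set" where
  "laakso_adj i = {(u, v). {u, v} \<in> laakso_edges i}"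

text \<open>The least number of edges of a walk from \<open>u\<close> to \<open>v\<close>, times the length \<open>4\<^sup>-\<^sup>i\<close> of each edge.\<close>

definition laakso_dist :: "nat \<Rightarrow> laakso_vertex \<Rightarrow> laakso_vertex \<Rightarrow> real" where
  "laakso_dist i u v = real (LEAST n. (u, v) \<in> laakso_adj i ^^ n) / 4 ^ i"

definition laakso_graph :: "nat \<Rightarrow> laakso_vertex metric" where
  "laakso_graph i = metric (laakso_verts i, laakso_dist i)"

text \<open>The graphs are connected, so that \<open>laakso_dist\<close> is a metric on the vertex set.\<close>

lemma laakso_ends: "End1 \<in> laakso_verts i" "End2 \<in> laakso_verts i"
proof (induction i)
  case (Suc i)
  { case 1
    have "place 4 End1 = End1" by (simp add: copy_ends_def)
    then show ?case using Suc by (auto intro!: bexI[of _ 4] image_eqI[of _ _ End1]) }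
  { case 2
    have "place 5 End2 = End2" by (simp add: copy_ends_def)
    then show ?case using Suc by (auto intro!: bexI[of _ 5] image_eqI[of _ _ End2]) }
qed auto

lemma finite_laakso_verts: "finite (laakso_verts i)"
  by (induction i) auto

lemma sym_laakso_adj: "sym (laakso_adj i)"
  by (auto simp: laakso_adj_def sym_def insert_commute)

lemma laakso_adj_place:
  assumes "k < 6" "(u, v) \<in> (laakso_adj i)\<^sup>*"
  shows "(place k u, place k v) \<in> (laakso_adj (Suc i))\<^sup>*"
  using assms(2)
proof (induction rule: rtrancl_induct)
  case (step v w)
  have "place k ` {v, w} \<in> laakso_edges (Suc i)"
    using step.hyps(2) assms(1) unfolding laakso_adj_def laakso_edges.simps by blast
  then have "(place k v, place k w) \<in> laakso_adj (Suc i)"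
    by (simp add: laakso_adj_def)
  then show ?case using step.IH by (rule rtrancl_into_rtrancl[rotated])
qed simp

lemma laakso_connected:
  "u \<in> laakso_verts i \<Longrightarrow> v \<in> laakso_verts i \<Longrightarrow> (u, v) \<in> (laakso_adj i)\<^sup>*"
proof (induction i arbitrary: u v)
  case 0
  then show ?case by (auto simp: laakso_adj_def insert_commute)
next
  case (Suc i)
  let ?R = "(laakso_adj (Suc i))\<^sup>*"
  have sym: "(y, x) \<in> ?R" if "(x, y) \<in> ?R" for x y
    using that sym_rtrancl[OF sym_laakso_adj] by (blast dest: symD)
  have c: "(fst (copy_ends k), snd (copy_ends k)) \<in> ?R" if "k < 6" for k
    using laakso_adj_place[OF that Suc.IH[OF laakso_ends(1) laakso_ends(2)]] by simp
  have 4: "(End1, Glue 0) \<in> ?R" using c[of 4] by (simp add: copy_ends_def)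
  have 0: "(Glue 0, Glue 1) \<in> ?R" using c[of 0] by (simp add: copy_ends_def)
  have 1: "(Glue 1, Glue 2) \<in> ?R" using c[of 1] by (simp add: copy_ends_def)
  have 3: "(Glue 0, Glue 3) \<in> ?R" using c[of 3] by (simp add: copy_ends_def)
  have g: "(End1, fst (copy_ends k)) \<in> ?R" if "k < 6" for k
  proof -
    have "k \<in> {0, 1, 2, 3, 4, 5}" using that by auto
    then show ?thesis
      using 4 0 1 3 by (auto simp: copy_ends_def intro: rtrancl_trans)
  qed
  have r: "(End1, w) \<in> ?R" if w: "w \<in> laakso_verts (Suc i)" for w
  proof -
    obtain k w' where k: "k < 6" "w' \<in> laakso_verts i" "w = place k w'" using w by auto
    have "(place k End1, w) \<in> ?R"
      using laakso_adj_place[OF k(1) Suc.IH[OF laakso_ends(1) k(2)]] k(3) by simp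
    then show ?thesis using g[OF k(1)] by (auto intro: rtrancl_trans)
  qed
  show ?case using r[OF Suc.prems(1)] r[OF Suc.prems(2)] sym by (blast intro: rtrancl_trans)
qed

lemma laakso_adj_pow_commute: "(u, v) \<in> laakso_adj i ^^ n \<longleftrightarrow> (v, u) \<in> laakso_adj i ^^ n"
proof -
  have "(v, u) \<in> laakso_adj i ^^ n" if "(u, v) \<in> laakso_adj i ^^ n" for u v
    using that
  proof (induction n arbitrary: v)
    case (Suc n)
    then obtain w where "(u, w) \<in> laakso_adj i ^^ n" "(w, v) \<in> laakso_adj i" by auto
    then show ?case using Suc.IH sym_laakso_adj by (metis symD relpow_Suc_I2)
  qed auto
  then show ?thesis by blast
qed

lemma Metric_space_laakso: "Metric_space (laakso_verts i) (laakso_dist i)"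
proof
  let ?L = "\<lambda>u v. LEAST n. (u, v) \<in> laakso_adj i ^^ n"
  have att: "(u, v) \<in> laakso_adj i ^^ ?L u v" if "u \<in> laakso_verts i" "v \<in> laakso_verts i" for u v
    using laakso_connected[OF that] unfolding rtrancl_power by (rule LeastI_ex)
  show "0 \<le> laakso_dist i x y" for x y by (simp add: laakso_dist_def)
  show "laakso_dist i x y = laakso_dist i y x" for x y
    by (simp add: laakso_dist_def laakso_adj_pow_commute[of x y])
  show "laakso_dist i x y = 0 \<longleftrightarrow> x = y" if "x \<in> laakso_verts i" "y \<in> laakso_verts i" for x y
  proof
    assume "laakso_dist i x y = 0"
    then have "?L x y = 0" by (simp add: laakso_dist_def)
    then show "x = y" using att[OF that] by simp
  next
    assume "x = y"
    then have "?L x y = 0" by (intro Least_eq_0) simp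
    then show "laakso_dist i x y = 0" by (simp add: laakso_dist_def)
  qed
  show "laakso_dist i x z \<le> laakso_dist i x y + laakso_dist i y z"
    if "x \<in> laakso_verts i" "y \<in> laakso_verts i" "z \<in> laakso_verts i" for x y z
  proof -
    have "(x, z) \<in> laakso_adj i ^^ (?L x y + ?L y z)"
      unfolding relpow_add using att[OF that(1,2)] att[OF that(2,3)] by blast
    then have "?L x z \<le> ?L x y + ?L y z" by (rule Least_le)
    then have "real (?L x z) \<le> real (?L x y) + real (?L y z)" by linarith
    then show ?thesis unfolding laakso_dist_def
      by (simp add: divide_right_mono flip: add_divide_distrib)
  qed
qed

lemma mspace_laakso_graph [simp]: "mspace (laakso_graph i) = laakso_verts i"
  by (simp add: laakso_graph_def Metric_space.mspace_metric[OF Metric_space_laakso])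

lemma mdist_laakso_graph [simp]: "mdist (laakso_graph i) = laakso_dist i"
  by (simp add: laakso_graph_def Metric_space.mdist_metric[OF Metric_space_laakso])

end

theory Submission
  imports Defs
begin

text \<open>
  Two points joined by two geodesics whose midpoints are far apart cannot be pulled apart at full
  stretch in a power type convex norm: if opposite corners \<open>b\<close> and \<open>d\<close> of a quadrilateral
  with sides of length at most \<open>R\<close> are far apart, then the other diagonal is shorter than
  \<open>2 * R\<close> by a definite amount (lemma \<open>diagonal\<close>).

  Let \<open>g\<close> be an embedding that does not shrink distances, and let \<open>E\<close> be the distance
  between the images of the two endpoints of the graph, which have distance 1. The graph consists
  of six copies scaled by 1/4. Of the stretches of their six pairs of endpoints let \<open>L\<close> be the
  largest. The images of the four gluing points form a quadrilateral with sides at most \<open>L / 4\<close>,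
  and the points \<open>Glue 1\<close> and \<open>Glue 3\<close>, at distance 1/2, stay at least 1/2 apart. Hence
  \<open>E \<le> L - gain * L powr (1 - p)\<close>, which implies \<open>E powr p + gain \<le> L powr p\<close>
  (lemma \<open>stretch_step\<close>). The copy with stretch \<open>L\<close>, rescaled by 4, is again embedded
  without shrinking distances, because the copies are isometric to the smaller graph up to scale,
  so the argument can be repeated down to a single edge. After \<open>m\<close> steps the \<open>p\<close>-th power of the
  stretch has grown by \<open>m * gain\<close> (lemma \<open>stretched_edge\<close>), whereas an edge is stretched
  at most by the Lipschitz constant. So the \<open>p\<close>-th power of the distortion grows at least
  linearly in \<open>m\<close>, while the logarithm of the number of vertices grows at most linearly.

  Apart from the length of an edge, the shortest-path metric enters only through lower bounds on
  distances, and these are certified by maps that change by at most one step along an edge: two integer potentials (\<open>height\<close> and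
  \<open>tent\<close>) and retractions of the graph onto its copies (\<open>retract\<close>).
\<close>

section \<open>Distances in the Laakso graphs\<close>

lemma laakso_edgeE:
  assumes "e \<in> laakso_edges i"
  obtains a b where "e = {a, b}" "a \<in> laakso_verts i" "b \<in> laakso_verts i"
proof -
  have "\<exists>a\<in>laakso_verts i. \<exists>b\<in>laakso_verts i. e = {a, b}"
    using assms
  proof (induction i arbitrary: e)
    case (Suc i)
    then obtain k e' where k: "k < 6" "e' \<in> laakso_edges i" "e = place k ` e'"
      by auto
    obtain a b where "a \<in> laakso_verts i" "b \<in> laakso_verts i" "e' = {a, b}"
      using Suc.IH[OF k(2)] by blast
    then show ?case
      using k by (intro bexI[of _ "place k a"] bexI[of _ "place k b"]) auto
  qed auto
  then show ?thesis using that by blast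
qed

lemma laakso_edges_Suc:
  "k < 6 \<Longrightarrow> {u, v} \<in> laakso_edges i \<Longrightarrow> {place k u, place k v} \<in> laakso_edges (Suc i)"
  by (auto intro!: bexI[of _ k] image_eqI[of _ _ "{u, v}"])

lemma laakso_adj_SucE:
  assumes "(u, v) \<in> laakso_adj (Suc i)"
  obtains k a b where "k < 6" "(a, b) \<in> laakso_adj i" "u = place k a" "v = place k b"
proof -
  obtain k e where k: "k < 6" "e \<in> laakso_edges i" "{u, v} = place k ` e"
    using assms by (auto simp: laakso_adj_def)
  obtain a b where e: "e = {a, b}"
    using laakso_edgeE[OF k(2)] by metis
  have "(a, b) \<in> laakso_adj i" "(b, a) \<in> laakso_adj i"
    using k(2) e by (auto simp: laakso_adj_def insert_commute)
  moreover have "u = place k a \<and> v = place k b \<or> u = place k b \<and> v = place k a"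
    using k(3) e by (auto simp: doubleton_eq_iff)
  ultimately show ?thesis using that k(1) by blast
qed

lemma less_6_cases: "k < 6 \<Longrightarrow> k \<in> {0, 1, 2, 3, 4, 5 :: nat}"
  by auto

lemma place_in_verts: "k < 6 \<Longrightarrow> v \<in> laakso_verts i \<Longrightarrow> place k v \<in> laakso_verts (Suc i)"
  by auto

lemma laakso_walk_exists:
  assumes "u \<in> laakso_verts i" "v \<in> laakso_verts i"
  obtains n where "(u, v) \<in> laakso_adj i ^^ n" "laakso_dist i u v = real n / 4 ^ i"
proof -
  have "\<exists>n. (u, v) \<in> laakso_adj i ^^ n"
    using laakso_connected[OF assms] unfolding rtrancl_power .
  then show ?thesis using that LeastI_ex unfolding laakso_dist_def by metis
qed

lemma laakso_dist_le_walk: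
  "(u, v) \<in> laakso_adj i ^^ n \<Longrightarrow> laakso_dist i u v \<le> real n / 4 ^ i"
  unfolding laakso_dist_def by (intro divide_right_mono) (auto intro: Least_le)

lemma laakso_dist_edge: "{u, v} \<in> laakso_edges i \<Longrightarrow> laakso_dist i u v \<le> 1 / 4 ^ i"
  using laakso_dist_le_walk[of u v 1 i] by (simp add: laakso_adj_def)

lemma laakso_dist_ge_potential:
  fixes F :: "laakso_vertex \<Rightarrow> int"
  assumes F: "\<And>u v. (u, v) \<in> laakso_adj i \<Longrightarrow> \<bar>F u - F v\<bar> \<le> 1"
    and uv: "u \<in> laakso_verts i" "v \<in> laakso_verts i"
  shows "real_of_int \<bar>F u - F v\<bar> / 4 ^ i \<le> laakso_dist i u v"
proof -
  have walk: "\<bar>F u - F v\<bar> \<le> int n" if "(u, v) \<in> laakso_adj i ^^ n" for n v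
    using that
  proof (induction n arbitrary: v)
    case (Suc n)
    then obtain w where "(u, w) \<in> laakso_adj i ^^ n" "(w, v) \<in> laakso_adj i" by auto
    then show ?case using Suc.IH[of w] F[of w v] by auto
  qed auto
  obtain n where n: "(u, v) \<in> laakso_adj i ^^ n" "laakso_dist i u v = real n / 4 ^ i"
    using laakso_walk_exists[OF uv] .
  have "real_of_int \<bar>F u - F v\<bar> \<le> real n" using walk[OF n(1)] by linarith
  then show ?thesis unfolding n(2) by (rule divide_right_mono) simp
qed

text \<open>The position of a copy on the way from \<open>End1\<close> to \<open>End2\<close>. The first endpoint of
  every copy is the one that is closer to \<open>End1\<close>, so the two copies of a layer are traversed
  in parallel.\<close>

definition layer :: "nat \<Rightarrow> nat" where
  "layer k = [1, 2, 2, 1, 0, 3] ! k"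

text \<open>The distance from \<open>End1\<close>, counted in edges. Terms that are not vertices of the graph
  get arbitrary values.\<close>

fun height :: "nat \<Rightarrow> laakso_vertex \<Rightarrow> int" where
  "height i End1 = 0"
| "height i End2 = 4 ^ i"
| "height (Suc i) (Glue j) = [1, 2, 3, 2] ! j * 4 ^ i"
| "height (Suc i) (Inner k v) = int (layer k) * 4 ^ i + height i v"
| "height 0 v = 0"

lemma height_place:
  "k < 6 \<Longrightarrow> height (Suc i) (place k v) = int (layer k) * 4 ^ i + height i v"
  by (cases v) (auto dest!: less_6_cases simp: copy_ends_def layer_def)

lemma height_adj: "(u, v) \<in> laakso_adj i \<Longrightarrow> \<bar>height i u - height i v\<bar> \<le> 1"
proof (induction i arbitrary: u v)
  case 0
  then show ?case by (auto simp: laakso_adj_def doubleton_eq_iff)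
next
  case (Suc i)
  then show ?case by (metis laakso_adj_SucE height_place add_diff_cancel_left)
qed

lemma laakso_dist_ends: "1 \<le> laakso_dist i End1 End2"
  using laakso_dist_ge_potential[of i "height i", OF height_adj laakso_ends] by simp

text \<open>A signed height over the cycle of the graph \<open>Suc i\<close>: from 0 at \<open>Glue 0\<close> and
  \<open>Glue 2\<close> it rises to \<open>4 ^ i\<close> at \<open>Glue 1\<close> and falls to \<open>- (4 ^ i)\<close> at
  \<open>Glue 3\<close>; it vanishes on the two stems. Its variation separates \<open>Glue 1\<close> from
  \<open>Glue 3\<close>, which \<open>height\<close> cannot do. The two lists give the value at the first
  endpoint of each copy and the slope along the copy.\<close>

fun tent :: "nat \<Rightarrow> laakso_vertex \<Rightarrow> int" where
  "tent i (Glue j) = [0, 1, 0, -1] ! j * 4 ^ i"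
| "tent i (Inner k v) =
     [0, 1, -1, 0, 0, 0] ! k * 4 ^ i + [1, -1, 1, -1, 0, 0] ! k * height i v"
| "tent i v = 0"

lemma tent_place:
  "k < 6 \<Longrightarrow> tent i (place k v) =
     [0, 1, -1, 0, 0, 0] ! k * 4 ^ i + [1, -1, 1, -1, 0, 0] ! k * height i v"
  by (cases v) (auto dest!: less_6_cases simp: copy_ends_def)

lemma tent_adj:
  assumes "(u, v) \<in> laakso_adj (Suc i)"
  shows "\<bar>tent i u - tent i v\<bar> \<le> 1"
proof -
  obtain k a b where k: "k < 6" "(a, b) \<in> laakso_adj i" "u = place k a" "v = place k b"
    using laakso_adj_SucE[OF assms] .
  have "\<bar>height i a - height i b\<bar> \<le> 1" using height_adj[OF k(2)] .
  then show ?thesis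
    using less_6_cases[OF k(1)] unfolding k(3,4) tent_place[OF k(1)] by auto
qed

lemma glue_in_verts: "Glue 1 \<in> laakso_verts (Suc i)" "Glue 3 \<in> laakso_verts (Suc i)"
proof -
  show "Glue 1 \<in> laakso_verts (Suc i)"
    using place_in_verts[of 1 End1 i] laakso_ends by (simp add: copy_ends_def)
  show "Glue 3 \<in> laakso_verts (Suc i)"
    using place_in_verts[of 2 End1 i] laakso_ends by (simp add: copy_ends_def)
qed

lemma laakso_dist_glue: "1 / 2 \<le> laakso_dist (Suc i) (Glue 1) (Glue 3)"
  using laakso_dist_ge_potential[of "Suc i" "tent i", OF tent_adj glue_in_verts]
  by (simp add: field_simps)

text \<open>Folds the graph onto a smaller copy of itself: the copies of layer \<open>j\<close> are
  superposed, everything before them collapses to \<open>End1\<close> and everything after them to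
  \<open>End2\<close>. Both copies of a layer start and end on the same side, which makes the pieces
  agree at the gluing points.\<close>

fun retract :: "nat \<Rightarrow> laakso_vertex \<Rightarrow> laakso_vertex" where
  "retract j End1 = End1"
| "retract j End2 = End2"
| "retract j (Glue l) = (if j < [1, 2, 3, 2] ! l then End2 else End1)"
| "retract j (Inner k v) = (if layer k = j then v else if layer k < j then End1 else End2)"

lemma retract_place:
  "k < 6 \<Longrightarrow> j < 4 \<Longrightarrow> retract j (place k v) =
     (if layer k = j then v else if layer k < j then End1 else End2)"
  by (cases v) (auto dest!: less_6_cases simp: copy_ends_def layer_def)

lemma retract_adj:
  assumes "j < 4" "(u, v) \<in> laakso_adj (Suc i)"
  shows "retract j u = retract j v \<or> (retract j u, retract j v) \<in> laakso_adj i"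
  using laakso_adj_SucE[OF assms(2)] retract_place[OF _ assms(1)] by metis

text \<open>A shortest walk may leave the copy, for instance around the cycle, so the walk is folded back
  into the copy; an edge either survives the folding or collapses to a point.\<close>

lemma laakso_dist_place:
  assumes k: "k < 6" and uv: "u \<in> laakso_verts i" "v \<in> laakso_verts i"
  shows "laakso_dist i u v \<le> 4 * laakso_dist (Suc i) (place k u) (place k v)"
proof -
  let ?r = "retract (layer k)"
  have j: "layer k < 4" using less_6_cases[OF k] by (auto simp: layer_def)
  have walk: "\<exists>n'\<le>n. (?r x, ?r y) \<in> laakso_adj i ^^ n'"
    if "(x, y) \<in> laakso_adj (Suc i) ^^ n" for n x y
    using that
  proof (induction n arbitrary: y)
    case (Suc n)
    then obtain w where w: "(x, w) \<in> laakso_adj (Suc i) ^^ n" "(w, y) \<in> laakso_adj (Suc i)"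
      by auto
    obtain n' where n': "n' \<le> n" "(?r x, ?r w) \<in> laakso_adj i ^^ n'"
      using Suc.IH[OF w(1)] by blast
    show ?case using retract_adj[OF j w(2)]
    proof
      assume "?r w = ?r y"
      then show ?thesis using n' by (intro exI[of _ n']) auto
    next
      assume "(?r w, ?r y) \<in> laakso_adj i"
      then show ?thesis using n' by (intro exI[of _ "Suc n'"]) auto
    qed
  qed auto
  obtain n where n: "(place k u, place k v) \<in> laakso_adj (Suc i) ^^ n"
      "laakso_dist (Suc i) (place k u) (place k v) = real n / 4 ^ Suc i"
    using laakso_walk_exists[OF place_in_verts[OF k uv(1)] place_in_verts[OF k uv(2)]] .
  obtain n' where n': "n' \<le> n" "(u, v) \<in> laakso_adj i ^^ n'"
    using walk[OF n(1)] retract_place[OF k j] by auto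
  have "laakso_dist i u v \<le> real n' / 4 ^ i" by (rule laakso_dist_le_walk[OF n'(2)])
  also have "\<dots> \<le> real n / 4 ^ i" using n'(1) by (intro divide_right_mono) auto
  finally show ?thesis using n(2) by simp
qed

text \<open>Gluing is ignored; the logarithm of the crude count is of the right order.\<close>

lemma card_laakso_verts: "card (laakso_verts i) \<le> 2 * 6 ^ i"
proof (induction i)
  case (Suc i)
  have "card (laakso_verts (Suc i)) \<le> (\<Sum>k<6. card (place k ` laakso_verts i))"
    unfolding laakso_verts.simps by (rule card_UN_le) simp
  also have "\<dots> \<le> (\<Sum>k<6::nat. 2 * 6 ^ i)"
    using Suc by (intro sum_mono) (meson card_image_le finite_laakso_verts order_trans)
  finally show ?case by simp
qed simp

section \<open>Uniformly convex norms of power type\<close>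

text \<open>The value 1 for the exponent is where the argument starts to work: powers of numbers in the
  unit interval are then at most the numbers themselves.\<close>

locale power_type_convex_norm =
  fixes N :: "'a::real_normed_vector \<Rightarrow> real" and p K :: real
  assumes equivalent: "equivalent_norm N"
    and p_ge_1: "1 \<le> p"
    and K_pos: "0 < K"
    and sphere: "N x = 1 \<Longrightarrow> N y = 1 \<Longrightarrow> N ((x + y) /\<^sub>R 2) \<le> 1 - K * N (x - y) powr p"
begin

lemma nonneg [simp]: "0 \<le> N x"
  using equivalent by (auto simp: equivalent_norm_def)

lemma scale: "N (a *\<^sub>R x) = \<bar>a\<bar> * N x"
  using equivalent by (auto simp: equivalent_norm_def)

lemma triangle: "N (x + y) \<le> N x + N y"
  using equivalent by (auto simp: equivalent_norm_def)

lemma minus_commute: "N (x - y) = N (y - x)"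
  using scale[of "-1" "x - y"] by simp

lemma triangle_diff: "N (x - z) \<le> N (x - y) + N (y - z)"
  using triangle[of "x - y" "y - z"] by simp

text \<open>The constant that replaces \<open>K\<close> when convexity passes from the unit sphere to the unit
  ball. The factor \<open>2 powr p\<close> in the denominator pays for moving two vectors to the sphere,
  which may halve their distance; the bound 1/2 covers the case in which one vector is well inside the ball.\<close>

definition modulus :: real where "modulus = min K (1 / 2) / 2 powr p"

lemma modulus_pos: "0 < modulus"
  using K_pos by (simp add: modulus_def)

text \<open>If \<open>y\<close> is shorter than 1 by a definite part of \<open>N (x - y)\<close>, the triangle inequality
  suffices, as a power of a number in the unit interval is at most that number. Otherwise the
  directions \<open>u\<close> and \<open>v\<close> of \<open>x\<close> and \<open>y\<close> keep half of the distance, and convexity on the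
  sphere applies to them. Replacing \<open>x + y\<close> by \<open>u + v\<close> through the triangle inequality
  would cost more than convexity gains; instead only the excess of \<open>x\<close> over the length of \<open>y\<close>
  is split off.\<close>

lemma ball_ordered:
  assumes le: "N x \<le> 1" "N y \<le> N x"
  shows "N (x + y) \<le> 2 - modulus * N (x - y) powr p"
proof -
  define \<delta> a b where "\<delta> = N (x - y)" and "a = N x" and "b = N y"
  have ab: "a \<le> 1" "b \<le> a" using le by (auto simp: a_def b_def)
  have \<delta>: "0 \<le> \<delta>" "\<delta> \<le> 2"
    using triangle_diff[of x y 0] minus_commute[of 0 y] le by (auto simp: \<delta>_def)
  have modulus: "modulus * \<delta> powr p = min K (1 / 2) * (\<delta> / 2) powr p"
    using \<delta> by (simp add: modulus_def powr_divide)
  show ?thesis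
  proof (cases "b < 1 - \<delta> / 4")
    case True
    have "(\<delta> / 2) powr p \<le> (\<delta> / 2) powr 1"
      using \<delta> p_ge_1 by (intro powr_mono') auto
    then have "min K (1 / 2) * (\<delta> / 2) powr p \<le> 1 / 2 * (\<delta> / 2)"
      using \<delta> K_pos by (intro mult_mono) auto
    moreover have "N (x + y) \<le> a + b"
      using triangle by (simp add: a_def b_def)
    ultimately show ?thesis using True ab modulus unfolding \<delta>_def[symmetric] by linarith
  next
    case False
    then have b: "1 / 2 \<le> b" using \<delta> by linarith
    define u v where "u = x /\<^sub>R a" and "v = y /\<^sub>R b"
    have x: "x = a *\<^sub>R u" and y: "y = b *\<^sub>R v" using b ab by (auto simp: u_def v_def)
    have N1: "N u = 1" "N v = 1"
      using b ab by (auto simp: u_def v_def scale simp flip: a_def b_def)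
    have "N (x - y) \<le> N (x - u) + N (u - v) + N (v - y)"
      using triangle_diff[of x y u] triangle_diff[of u y v] by linarith
    moreover have "N (x - u) = 1 - a"
    proof -
      have "x - u = (a - 1) *\<^sub>R u" using x by (simp add: algebra_simps)
      then show ?thesis using ab by (simp add: scale N1)
    qed
    moreover have "N (v - y) = 1 - b"
    proof -
      have "v - y = (1 - b) *\<^sub>R v" using y by (simp add: algebra_simps)
      then show ?thesis using ab by (simp add: scale N1)
    qed
    ultimately have "\<delta> / 2 \<le> N (u - v)" using False ab unfolding \<delta>_def by linarith
    then have "min K (1 / 2) * (\<delta> / 2) powr p \<le> K * N (u - v) powr p"
      using \<delta> K_pos p_ge_1 by (intro mult_mono powr_mono2) auto
    then have uv: "N ((u + v) /\<^sub>R 2) \<le> 1 - modulus * \<delta> powr p"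
      using sphere[OF N1] modulus by linarith
    have "0 \<le> modulus * \<delta> powr p" using modulus_pos by simp
    then have half: "modulus * \<delta> powr p \<le> 2 * b * (modulus * \<delta> powr p)"
      using b mult_right_mono[of 1 "2 * b" "modulus * \<delta> powr p"] by simp
    have "x + y = (a - b) *\<^sub>R u + (2 * b) *\<^sub>R ((u + v) /\<^sub>R 2)"
      unfolding x y by (simp add: algebra_simps)
    then have "N (x + y) \<le> (a - b) + 2 * b * N ((u + v) /\<^sub>R 2)"
      using triangle[of "(a - b) *\<^sub>R u" "(2 * b) *\<^sub>R ((u + v) /\<^sub>R 2)"] ab b N1
      by (simp only: scale) simp
    also have "\<dots> \<le> (a - b) + 2 * b * (1 - modulus * \<delta> powr p)"
      using uv b by (intro add_left_mono mult_left_mono) auto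
    also have "\<dots> \<le> 2 - modulus * \<delta> powr p"
      using half ab by (simp add: algebra_simps)
    finally show ?thesis by (simp add: \<delta>_def)
  qed
qed

lemma ball:
  assumes "0 < R" "N x \<le> R" "N y \<le> R"
  shows "N (x + y) \<le> 2 * R - modulus * R * (N (x - y) / R) powr p"
proof -
  have unit: "N (x + y) \<le> 2 - modulus * N (x - y) powr p" if "N x \<le> 1" "N y \<le> 1" for x y
    using ball_ordered[of x y] ball_ordered[of y x] that minus_commute[of x y]
    by (cases "N y \<le> N x") (auto simp: add.commute)
  have s: "N (z /\<^sub>R R) = N z / R" for z
    using assms(1) by (simp add: scale field_simps)
  have "N (x /\<^sub>R R) \<le> 1" "N (y /\<^sub>R R) \<le> 1"
    unfolding s using assms by simp_all
  then have "N ((x + y) /\<^sub>R R) \<le> 2 - modulus * N ((x - y) /\<^sub>R R) powr p"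
    unfolding scaleR_right_distrib scaleR_right_diff_distrib by (rule unit)
  then have "N (x + y) / R \<le> 2 - modulus * (N (x - y) / R) powr p"
    unfolding s .
  then have "N (x + y) / R * R \<le> (2 - modulus * (N (x - y) / R) powr p) * R"
    using assms(1) by (intro mult_right_mono) auto
  then show ?thesis using assms(1) by (simp add: algebra_simps)
qed

text \<open>Both paths from \<open>a\<close> to \<open>c\<close> have the same sum, so \<open>b\<close> and \<open>d\<close> differ from the midpoint of
  \<open>a\<close> and \<open>c\<close> by half of \<open>s\<close> and \<open>t\<close>, respectively. One of the two points is therefore at least
  \<open>N (b - d) / 2\<close> away from the midpoint, and convexity is applied to the two steps of its path.\<close>

lemma diagonal:
  assumes R: "0 < R"
    and le: "N (b - a) \<le> R" "N (c - b) \<le> R" "N (d - a) \<le> R" "N (c - d) \<le> R"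
  shows "N (c - a) \<le> 2 * R - modulus * R * (N (b - d) / R) powr p"
proof -
  have mono: ?thesis if "N (c - a) \<le> 2 * R - modulus * R * (t / R) powr p" "N (b - d) \<le> t" for t
  proof -
    have "modulus * R * (N (b - d) / R) powr p \<le> modulus * R * (t / R) powr p"
      using that(2) R modulus_pos p_ge_1
      by (intro mult_left_mono powr_mono2 divide_right_mono) auto
    then show ?thesis using that(1) by linarith
  qed
  define s t where "s = (b - a) - (c - b)" and "t = (d - a) - (c - d)"
  have "2 * N (b - d) = N (s - t)"
  proof -
    have "s - t = 2 *\<^sub>R (b - d)" by (simp add: s_def t_def algebra_simps scaleR_2)
    then show ?thesis by (simp add: scale)
  qed
  also have "\<dots> \<le> N s + N t"
    using triangle_diff[of s t 0] minus_commute[of 0 t] by simp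
  finally have "N (b - d) \<le> N s \<or> N (b - d) \<le> N t" by linarith
  moreover have "N (c - a) \<le> 2 * R - modulus * R * (N s / R) powr p"
    using ball[OF R le(1,2)] by (simp add: s_def)
  moreover have "N (c - a) \<le> 2 * R - modulus * R * (N t / R) powr p"
    using ball[OF R le(3,4)] by (simp add: t_def)
  ultimately show ?thesis using mono by blast
qed

section \<open>Stretch increases from each scale to the next\<close>

text \<open>The loss in \<open>diagonal\<close> for \<open>R = L / 4\<close> and midpoints at distance 1/2 is
  \<open>gain * L powr (1 - p)\<close>.\<close>

definition gain :: real where "gain = modulus / 4 * 2 powr p"

lemma gain_pos: "0 < gain"
  using modulus_pos by (simp add: gain_def)

text \<open>The copy with the largest stretch \<open>L\<close> is chosen. The two stems contribute at most
  \<open>L / 4\<close> each, and the cycle contributes a diagonal that is strictly shorter than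
  \<open>L / 2\<close>. Taking \<open>p\<close>-th powers turns the loss, which depends on \<open>L\<close>, into a constant.\<close>

lemma stretch_step:
  assumes "\<And>u v. u \<in> laakso_verts (Suc i) \<Longrightarrow> v \<in> laakso_verts (Suc i) \<Longrightarrow>
             laakso_dist (Suc i) u v \<le> N (g u - g v)"
  obtains k where "k < 6"
    "N (g End1 - g End2) powr p + gain \<le>
       (4 * N (g (place k End1) - g (place k End2))) powr p"
proof -
  define S where "S k = N (g (place k End1) - g (place k End2))" for k
  obtain k where k: "k < 6" "\<And>l. l < 6 \<Longrightarrow> S l \<le> S k"
  proof -
    have "Max (S ` {..<6}) \<in> S ` {..<6}" by (rule Max_in) (auto simp: lessThan_empty_iff)
    then obtain k where "k < 6" "S k = Max (S ` {..<6})" by auto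
    then show ?thesis using that[of k] Max_ge[of "S ` {..<6}"] by simp
  qed
  define R L where "R = S k" and "L = 4 * R"
  have S: "N (g End1 - g (Glue 0)) \<le> R" "N (g (Glue 2) - g End2) \<le> R"
      "N (g (Glue 1) - g (Glue 0)) \<le> R" "N (g (Glue 2) - g (Glue 1)) \<le> R"
      "N (g (Glue 3) - g (Glue 0)) \<le> R" "N (g (Glue 2) - g (Glue 3)) \<le> R"
    using k(2)[of 4] k(2)[of 5] k(2)[of 0] k(2)[of 1] k(2)[of 3] k(2)[of 2]
    by (simp_all add: S_def R_def copy_ends_def minus_commute)
  have far: "1 / 2 \<le> N (g (Glue 1) - g (Glue 3))"
    using assms[OF glue_in_verts] laakso_dist_glue[of i] by linarith
  have R: "0 < R"
    using far triangle_diff[of "g (Glue 1)" "g (Glue 3)" "g (Glue 0)"] S(3,5)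
      minus_commute[of "g (Glue 0)" "g (Glue 3)"] by linarith
  have L: "0 < L" using R by (simp add: L_def)
  have "gain * L * L powr - p = modulus * R * (1 / 2 / R) powr p"
  proof -
    have half: "1 / 2 / R = 2 / L" by (simp add: L_def)
    have "(1 / 2 / R) powr p = 2 powr p * L powr - p"
      unfolding half using L by (simp add: powr_divide powr_minus_divide)
    then show ?thesis by (simp add: gain_def L_def)
  qed
  also have "\<dots> \<le> modulus * R * (N (g (Glue 1) - g (Glue 3)) / R) powr p"
    using far R modulus_pos p_ge_1 by (intro mult_left_mono powr_mono2 divide_right_mono) auto
  finally have "N (g (Glue 2) - g (Glue 0)) \<le> 2 * R - gain * L * L powr - p"
    using diagonal[OF R S(3,4,5,6)] by linarith
  then have E: "N (g End1 - g End2) \<le> L * (1 - gain * L powr - p)"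
    using S(1,2) triangle_diff[of "g End1" "g End2" "g (Glue 0)"]
      triangle_diff[of "g (Glue 0)" "g End2" "g (Glue 2)"]
      minus_commute[of "g (Glue 0)" "g (Glue 2)"]
    by (simp add: L_def algebra_simps)
  define q where "q = 1 - gain * L powr - p"
  have "0 \<le> L * q" using E nonneg order_trans unfolding q_def by blast
  then have q: "0 \<le> q" "q \<le> 1"
    using L gain_pos by (auto simp: zero_le_mult_iff q_def)
  \<comment> \<open>\<open>q powr p \<le> q\<close> replaces the Bernoulli inequality; \<open>0 \<le> q\<close> was forced by
    the nonnegativity of the norm.\<close>
  have "N (g End1 - g End2) powr p \<le> (L * q) powr p"
    using E p_ge_1 unfolding q_def by (intro powr_mono2) auto
  also have "\<dots> = L powr p * q powr p"
    using L q by (simp add: powr_mult)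
  also have "\<dots> \<le> L powr p * q powr 1"
    using q p_ge_1 by (intro mult_left_mono powr_mono') auto
  also have "\<dots> = L powr p - gain * (L powr p * L powr - p)"
    using q by (simp add: q_def algebra_simps)
  also have "L powr p * L powr - p = 1"
    using L by (simp flip: powr_add)
  finally have "N (g End1 - g End2) powr p + gain \<le> L powr p" by simp
  then show ?thesis using that[OF k(1)] by (simp add: L_def R_def S_def)
qed

text \<open>A descent through the scales: \<open>stretch_step\<close> selects a copy, and the embedding
  restricted to this copy and enlarged by the factor 4 satisfies the hypothesis again by
  \<open>laakso_dist_place\<close>.\<close>

lemma stretched_edge:
  assumes "\<And>u v. u \<in> laakso_verts m \<Longrightarrow> v \<in> laakso_verts m \<Longrightarrow>
             laakso_dist m u v \<le> N (g u - g v)"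
  shows "\<exists>u v. {u, v} \<in> laakso_edges m \<and>
           N (g End1 - g End2) powr p + real m * gain \<le> (4 ^ m * N (g u - g v)) powr p"
  using assms
proof (induction m arbitrary: g)
  case 0
  show ?case by (intro exI[of _ End1] exI[of _ End2]) simp
next
  case (Suc m)
  obtain k where k: "k < 6" "N (g End1 - g End2) powr p + gain \<le>
       (4 * N (g (place k End1) - g (place k End2))) powr p"
    using stretch_step[of m g] Suc.prems by metis
  define h where "h v = 4 *\<^sub>R g (place k v)" for v
  have h: "N (h u - h v) = 4 * N (g (place k u) - g (place k v))" for u v
    unfolding h_def scaleR_right_diff_distrib[symmetric] scale by simp
  have "laakso_dist m u v \<le> N (h u - h v)" if "u \<in> laakso_verts m" "v \<in> laakso_verts m" for u v
    using laakso_dist_place[OF k(1) that] Suc.prems place_in_verts[OF k(1)] that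
    unfolding h by (meson mult_left_mono order_trans zero_le_numeral)
  from Suc.IH[OF this] obtain u v where uv: "{u, v} \<in> laakso_edges m"
      "N (h End1 - h End2) powr p + real m * gain \<le> (4 ^ m * N (h u - h v)) powr p"
    by blast
  have "N (g End1 - g End2) powr p + real (Suc m) * gain \<le>
      (4 ^ Suc m * N (g (place k u) - g (place k v))) powr p"
    using k(2) uv(2) unfolding h by (simp add: algebra_simps)
  then show ?case using laakso_edges_Suc[OF k(1) uv(1)] by blast
qed

text \<open>The summand 1 is a lower bound for the stretch of the endpoints of the whole graph; it
  keeps the bound away from 0 for the graph with a single edge.\<close>

lemma lipschitz_lower_bound:
  assumes lower: "\<And>u v. u \<in> laakso_verts m \<Longrightarrow> v \<in> laakso_verts m \<Longrightarrow>
             laakso_dist m u v \<le> N (g u - g v)"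
    and upper: "\<And>u v. u \<in> laakso_verts m \<Longrightarrow> v \<in> laakso_verts m \<Longrightarrow>
             N (g u - g v) \<le> D * laakso_dist m u v"
  shows "1 + real m * gain \<le> D powr p" and "0 < D"
proof -
  have 1: "1 \<le> N (g End1 - g End2)"
    using lower[OF laakso_ends] laakso_dist_ends[of m] by linarith
  have "0 < D * laakso_dist m End1 End2"
    using upper[OF laakso_ends] 1 by linarith
  then show D: "0 < D"
    using laakso_dist_ends[of m] by (simp add: zero_less_mult_iff)
  obtain u v where uv: "{u, v} \<in> laakso_edges m"
      "N (g End1 - g End2) powr p + real m * gain \<le> (4 ^ m * N (g u - g v)) powr p"
    using stretched_edge[of m g] lower by blast
  have V: "u \<in> laakso_verts m" "v \<in> laakso_verts m"
    using laakso_edgeE[OF uv(1)] by (metis doubleton_eq_iff)+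
  have "N (g u - g v) \<le> D * laakso_dist m u v" by (rule upper[OF V])
  also have "\<dots> \<le> D * (1 / 4 ^ m)"
    using laakso_dist_edge[OF uv(1)] D by (intro mult_left_mono) auto
  finally have "4 ^ m * N (g u - g v) \<le> D" by (simp add: field_simps)
  then have "(4 ^ m * N (g u - g v)) powr p \<le> D powr p"
    using p_ge_1 by (intro powr_mono2) auto
  moreover have "1 \<le> N (g End1 - g End2) powr p"
    using 1 p_ge_1 by (simp add: ge_one_powr_ge_zero)
  ultimately show "1 + real m * gain \<le> D powr p" using uv(2) by linarith
qed

end

section \<open>The distortion of the Laakso graphs\<close>

lemma ln_card_laakso_verts: "ln (real (card (laakso_verts m))) \<le> ln 6 * (1 + real m)"
proof -
  have "0 < card (laakso_verts m)"
    using laakso_ends finite_laakso_verts by (auto simp: card_gt_0_iff)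
  moreover have "card (laakso_verts m) \<le> 6 ^ Suc m"
    using card_laakso_verts[of m] by simp
  then have "real (card (laakso_verts m)) \<le> 6 ^ Suc m"
    by (metis of_nat_le_iff of_nat_numeral of_nat_power)
  ultimately have "ln (real (card (laakso_verts m))) \<le> ln (6 ^ Suc m)"
    by (subst ln_le_cancel_iff) auto
  also have "\<dots> = ln 6 * (1 + real m)"
    by (simp add: ln_realpow ln_mult algebra_simps)
  finally show ?thesis .
qed

theorem theorem1p6:
  fixes p :: real
  assumes "p \<ge> 2"
    and "p_convex p TYPE('a::banach)"
  shows "\<exists>c>0. \<forall>m. distortion (euclidean_metric :: 'a metric) (laakso_graph m)
           \<ge> ereal (c * ln (real (card (mspace (laakso_graph m)))) powr (1 / p))"
proof -
  obtain N :: "'a \<Rightarrow> real" and K where N: "equivalent_norm N" "0 < K"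
      "\<And>x y. N x = 1 \<Longrightarrow> N y = 1 \<Longrightarrow> N ((x + y) /\<^sub>R 2) \<le> 1 - K * N (x - y) powr p"
    using assms(2) unfolding p_convex_def by blast
  interpret power_type_convex_norm N p K
    using N assms(1) by unfold_locales auto
  obtain A B where AB: "0 < A" "0 < B" "\<And>x. A * norm x \<le> N x" "\<And>x. N x \<le> B * norm x"
    using N(1) unfolding equivalent_norm_def by blast
  \<comment> \<open>\<open>w\<close> compares \<open>1 + real m * gain\<close> with the logarithm of the number of vertices; the
    factor \<open>A / B\<close> is the price of passing to the norm \<open>N\<close>.\<close>
  define w where "w = min 1 gain / ln 6"
  define c where "c = A / B * w powr (1 / p)"
  have w: "0 < w" using gain_pos by (simp add: w_def)
  have c: "0 < c" using AB w by (simp add: c_def)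
  have bound: "c * ln (real (card (laakso_verts m))) powr (1 / p) \<le> D"
    if D: "D > 0" "r > 0" and f: "\<And>x y. x \<in> laakso_verts m \<Longrightarrow> y \<in> laakso_verts m \<Longrightarrow>
        r * laakso_dist m x y \<le> dist (f x) (f y) \<and> dist (f x) (f y) \<le> D * r * laakso_dist m x y"
    for D r m and f :: "laakso_vertex \<Rightarrow> 'a"
  proof -
    \<comment> \<open>Normalised so that \<open>g\<close> does not shrink distances as measured by \<open>N\<close>.\<close>
    define g where "g x = f x /\<^sub>R (A * r)" for x
    define C where "C = B / A * D"
    have g: "N (g x - g y) = N (f x - f y) / (A * r)" for x y
      unfolding g_def scaleR_right_diff_distrib[symmetric] scale
      using AB D by (simp add: field_simps)
    have lo: "laakso_dist m x y \<le> N (g x - g y)"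
      and up: "N (g x - g y) \<le> C * laakso_dist m x y"
      if xy: "x \<in> laakso_verts m" "y \<in> laakso_verts m" for x y
    proof -
      have "A * (r * laakso_dist m x y) \<le> A * dist (f x) (f y)"
        using f[OF xy] AB by (intro mult_left_mono) auto
      also have "\<dots> \<le> N (f x - f y)" using AB by (simp add: dist_norm)
      finally show "laakso_dist m x y \<le> N (g x - g y)"
        unfolding g using AB D by (simp add: field_simps)
      have "N (f x - f y) \<le> B * dist (f x) (f y)" using AB by (simp add: dist_norm)
      also have "\<dots> \<le> B * (D * r * laakso_dist m x y)"
        using f[OF xy] AB by (intro mult_left_mono) auto
      finally show "N (g x - g y) \<le> C * laakso_dist m x y"
        unfolding g C_def using AB D by (simp add: field_simps)
    qed
    have C: "1 + real m * gain \<le> C powr p" "0 < C"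
      using lipschitz_lower_bound[of m g C] lo up by blast+
    have ln0: "0 \<le> ln (real (card (laakso_verts m)))"
      using laakso_ends finite_laakso_verts
      by (intro ln_ge_zero) (auto simp: Suc_le_eq card_gt_0_iff)
    have "w * ln (real (card (laakso_verts m))) \<le> w * (ln 6 * (1 + real m))"
      using w ln_card_laakso_verts by (intro mult_left_mono) auto
    also have "\<dots> = min 1 gain * 1 + real m * min 1 gain"
      by (simp add: w_def field_simps)
    also have "\<dots> \<le> 1 + real m * gain"
      by (intro add_mono mult_left_mono) auto
    also have "\<dots> \<le> C powr p" by (rule C)
    finally have "(w * ln (real (card (laakso_verts m)))) powr (1 / p) \<le> (C powr p) powr (1 / p)"
      using w ln0 assms(1) by (intro powr_mono2) auto
    also have "\<dots> = C" using C(2) assms(1) by (simp add: powr_powr)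
    finally have "w powr (1 / p) * ln (real (card (laakso_verts m))) powr (1 / p) \<le> B / A * D"
      using w ln0 by (simp add: powr_mult C_def)
    then show ?thesis using AB by (simp add: c_def field_simps)
  qed
  show ?thesis
  proof (intro exI[of _ c] conjI allI c)
    fix m
    show "ereal (c * ln (real (card (mspace (laakso_graph m)))) powr (1 / p))
        \<le> distortion (euclidean_metric :: 'a metric) (laakso_graph m)"
      unfolding distortion_def
    proof (rule Inf_greatest, clarsimp)
      fix D r :: real and f :: "laakso_vertex \<Rightarrow> 'a"
      assume "0 < D" "0 < r" "\<forall>x\<in>laakso_verts m. \<forall>y\<in>laakso_verts m.
        r * laakso_dist m x y \<le> dist (f x) (f y) \<and> dist (f x) (f y) \<le> D * r * laakso_dist m x y"
      then show "c * ln (real (card (laakso_verts m))) powr (1 / p) \<le> D"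
        by (intro bound[of D r m f]) auto
    qed
  qed
qed

end
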